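(* Let $L=L_1\cup L_2\cup L_3$ be a 3-component link in $S^3$ with vanishing pairwise linking numbers. Then $$C(L)\ \geq\ 2\left\lceil \sqrt{3\,|\mu_{123}(L)|}\,\right\rceil ,$$ where $C(L)$ is the clasp number of $L$ and $\mu_{123}(L)\in\mathbb{Z}$ is Milnor's triple linking number.
   Context: A 3-component link $L=L_1\cup L_2\cup L_3$ is an isotopy class of ordered, oriented, disjoint unions of three smoothly embedded circles in $S^3$. A C-complex for $L$ is a union $F=F_1\cup F_2\cup F_3$ of three smoothly embedded oriented compact surfaces in $S^3$ which intersect transversely and satisfy: (1) for each $i$, $\partial F_i=L_i$ and $F_i$ has no closed components; (2) for each $i\neq j$, $F_i\cap F_j$ is a (possibly empty) union of disjoint embedded arcs, each with one endpoint in $L_i$ and one endpoint in $L_j$; these arcs are called clasps; (3) $F_1\cap F_2\cap F_3=\emptyset$. The clasp number $C(L)$ is the minimal number of clasps amongst all C-complexes bounded by $L$. Signs: for $i\ne j$, a point of $L_i\cap F_j$ is positive ($+1$) if the positive tangent direction to $L_i$ agrees with the positive normal direction to $F_j$, and negative ($-1$) otherwise. Clasp-words: let $F$ be a C-complex for $L$, and fix base-points $p_i\in L_i$ (away from the other surfaces). For each $k$ the word $w_k=w_k(F)$ is obtained by starting at $p_k$ and following $L_k$ once around in the positive direction, recording $x_j^{\epsilon}$ each time $L_k$ meets $F_j$ ($j\neq k$) with sign $\epsilon=\pm1$. So $w_k$ is a word in $x_i^{\pm1},x_j^{\pm1}$ where $\{i,j,k\}=\{1,2,3\}$. For $\{i,j,k\}=\{1,2,3\}$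 and $w_k=\prod_{n=1}^N x_{a_n}^{\epsilon_n}$ with $a_n\in\{i,j\}$, $\epsilon_n=\pm1$, set $e_{ij}(w_k)=\sum_{1\le n<m\le N}\delta(a_n,i)\,\delta(a_m,j)\,\epsilon_n\epsilon_m$, where $\delta$ is the Kronecker delta. Triple linking number: when all pairwise linking numbers of $L$ vanish, Milnor's triple linking number is the integer given by the Mellor–Melvin formula $\mu_{123}(L)=e_{12}(w_3)+e_{23}(w_1)+e_{31}(w_2)$, computed from any C-complex $F$ for $L$ and any base-points (it is a known fact that the result is an invariant of $L$ independent of these choices). *)

theory Defs
  imports "HOL-Analysis.Analysis"
begin

section \<open>Smooth maps\<close>

primrec Ck_on :: "nat \<Rightarrow> 'a set \<Rightarrow> ('a::euclidean_space \<Rightarrow> 'b::euclidean_space) \<Rightarrow> bool" where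
  "Ck_on 0 S f \<longleftrightarrow> continuous_on S f"
| "Ck_on (Suc n) S f \<longleftrightarrow> (\<forall>x\<in>S. f differentiable (at x)) \<and>
     (\<forall>v. Ck_on n S (\<lambda>x. frechet_derivative f (at x) v))"

definition smooth_on :: "'a set \<Rightarrow> ('a::euclidean_space \<Rightarrow> 'b::euclidean_space) \<Rightarrow> bool" where
  "smooth_on S f \<longleftrightarrow> open S \<and> (\<forall>n. Ck_on n S f)"


section \<open>Links in the 3-sphere\<close>

text \<open>The 3-sphere is the unit sphere of \<open>real^4\<close>, oriented as the boundary of the unit ball:
  tangent vectors \<open>a, b, c\<close> at \<open>x\<close> form a positive basis iff \<open>det (x, a, b, c) > 0\<close>.\<close>

abbreviation S3 :: "(real^4) set" where
  "S3 \<equiv> sphere 0 1"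

definition tangent_S3 :: "real^4 \<Rightarrow> (real^4) set" where
  "tangent_S3 x = {v. v \<bullet> x = 0}"

text \<open>An oriented embedded circle is given by a regular 1-periodic parametrization.  Changing it by
  an orientation-preserving diffeomorphism of the circle does not leave the isotopy class below.\<close>

definition knot :: "(real \<Rightarrow> real^4) \<Rightarrow> bool" where
  "knot \<gamma> \<longleftrightarrow> smooth_on UNIV \<gamma> \<and> range \<gamma> \<subseteq> S3 \<and>
     (\<forall>t. \<gamma> (t + 1) = \<gamma> t) \<and> inj_on \<gamma> {0..<1} \<and>
     (\<forall>t. vector_derivative \<gamma> (at t) \<noteq> 0)"

type_synonym three_circles = "3 \<Rightarrow> real \<Rightarrow> real^4"

definition embedded_link :: "three_circles \<Rightarrow> bool" where
  "embedded_link l \<longleftrightarrow> (\<forall>i. knot (l i)) \<and>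
     (\<forall>i j. i \<noteq> j \<longrightarrow> range (l i) \<inter> range (l j) = {})"

definition isotopic :: "three_circles \<Rightarrow> three_circles \<Rightarrow> bool" where
  "isotopic l l' \<longleftrightarrow> (\<exists>H :: 3 \<Rightarrow> real \<times> real \<Rightarrow> real^4.
     (\<forall>i. smooth_on UNIV (H i)) \<and>
     (\<forall>s\<in>{0..1}. embedded_link (\<lambda>i t. H i (s, t))) \<and>
     (\<forall>i t. H i (0, t) = l i t) \<and> (\<forall>i t. H i (1, t) = l' i t))"

text \<open>A 3-component link is an isotopy class.\<close>

type_synonym link = "three_circles set"

definition links :: "link set" where
  "links = {l. embedded_link l} // {(l, l'). isotopic l l'}"


section \<open>Compact oriented surfaces in the 3-sphere\<close>

text \<open>\<open>surface_chart F V \<phi> U\<close>: \<open>\<phi>\<close> is an immersion of the open set \<open>V\<close> of the plane that restricts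
  to a homeomorphism from the part of \<open>V\<close> in the closed half-plane \<open>v$1 \<ge> 0\<close> onto the part of
  \<open>F\<close> in the open set \<open>U\<close>.  Charts at interior points may have \<open>V\<close> inside the open half-plane.\<close>

definition surface_chart ::
    "(real^4) set \<Rightarrow> (real^2) set \<Rightarrow> (real^2 \<Rightarrow> real^4) \<Rightarrow> (real^4) set \<Rightarrow> bool" where
  "surface_chart F V \<phi> U \<longleftrightarrow> open U \<and> smooth_on V \<phi> \<and>
     (\<forall>v\<in>V. inj (frechet_derivative \<phi> (at v))) \<and>
     (\<exists>\<psi>. homeomorphism (V \<inter> {v. v$1 \<ge> 0}) (F \<inter> U) \<phi> \<psi>)"

definition compact_surface :: "(real^4) set \<Rightarrow> bool" where
  "compact_surface F \<longleftrightarrow> compact F \<and> F \<subseteq> S3 \<and>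
     (\<forall>x\<in>F. \<exists>V \<phi> U. surface_chart F V \<phi> U \<and> x \<in> U)"

definition surface_boundary :: "(real^4) set \<Rightarrow> (real^4) set" where
  "surface_boundary F = {\<phi> v | V \<phi> U v. surface_chart F V \<phi> U \<and> v \<in> V \<and> v$1 = 0}"

definition tangent_plane :: "(real^4) set \<Rightarrow> real^4 \<Rightarrow> (real^4) set" where
  "tangent_plane F x = {frechet_derivative \<phi> (at v) w | V \<phi> U v w.
     surface_chart F V \<phi> U \<and> v \<in> V \<and> v$1 \<ge> 0 \<and> \<phi> v = x}"

text \<open>Since the 3-sphere is oriented, an orientation of a surface in it amounts to a continuous
  unit normal field, the positive normal: a basis \<open>a, b\<close> of a tangent plane is positive
  iff \<open>det (x, a, b, normal x) > 0\<close>.\<close>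

record oriented_surface =
  points :: "(real^4) set"
  normal :: "real^4 \<Rightarrow> real^4"

definition compact_oriented_surface :: "oriented_surface \<Rightarrow> bool" where
  "compact_oriented_surface S \<longleftrightarrow> compact_surface (points S) \<and>
     continuous_on (points S) (normal S) \<and>
     (\<forall>x\<in>points S. norm (normal S x) = 1 \<and> normal S x \<in> tangent_S3 x \<and>
        (\<forall>w\<in>tangent_plane (points S) x. normal S x \<bullet> w = 0))"

text \<open>At a boundary point \<open>\<phi> v\<close> the vector \<open>- frechet_derivative \<phi> (at v) (axis 1 1)\<close> points out
  of the surface, so this is the outward-vector-first boundary orientation.\<close>

definition oriented_boundary :: "oriented_surface \<Rightarrow> (real \<Rightarrow> real^4) \<Rightarrow> bool" where
  "oriented_boundary S \<gamma> \<longleftrightarrow> surface_boundary (points S) = range \<gamma> \<and>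
     (\<forall>t V \<phi> U v. surface_chart (points S) V \<phi> U \<and> v \<in> V \<and> v$1 = 0 \<and> \<phi> v = \<gamma> t \<longrightarrow>
        det (vector [\<gamma> t, - frechet_derivative \<phi> (at v) (axis 1 1),
                     vector_derivative \<gamma> (at t), normal S (\<gamma> t)] :: real^4^4) > 0)"

text \<open>A component of the surface is closed (as a surface) iff it misses the boundary.\<close>

definition spanning_surface :: "(real \<Rightarrow> real^4) \<Rightarrow> oriented_surface \<Rightarrow> bool" where
  "spanning_surface \<gamma> S \<longleftrightarrow> compact_oriented_surface S \<and> oriented_boundary S \<gamma> \<and>
     (\<forall>C\<in>components (points S). C \<inter> range \<gamma> \<noteq> {})"


section \<open>Intersections, signs and linking numbers\<close>

definition transverse_curve :: "(real \<Rightarrow> real^4) \<Rightarrow> oriented_surface \<Rightarrow> bool" where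
  "transverse_curve \<gamma> S \<longleftrightarrow> (\<forall>t. \<gamma> t \<in> points S \<longrightarrow>
     span (insert (vector_derivative \<gamma> (at t)) (tangent_plane (points S) (\<gamma> t))) = tangent_S3 (\<gamma> t))"

definition transverse_surfaces :: "oriented_surface \<Rightarrow> oriented_surface \<Rightarrow> bool" where
  "transverse_surfaces S T \<longleftrightarrow> (\<forall>x\<in>points S \<inter> points T.
     span (tangent_plane (points S) x \<union> tangent_plane (points T) x) = tangent_S3 x)"

definition crossing_sign :: "(real \<Rightarrow> real^4) \<Rightarrow> oriented_surface \<Rightarrow> real \<Rightarrow> int" where
  "crossing_sign \<gamma> S t = (if vector_derivative \<gamma> (at t) \<bullet> normal S (\<gamma> t) > 0 then 1 else - 1)"

definition algebraic_intersection :: "(real \<Rightarrow> real^4) \<Rightarrow> oriented_surface \<Rightarrow> int" where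
  "algebraic_intersection \<gamma> S = (\<Sum>t | t \<in> {0..<1} \<and> \<gamma> t \<in> points S. crossing_sign \<gamma> S t)"

text \<open>The linking number of the components \<open>i\<close> and \<open>j\<close> is the common value of the algebraic
  intersection numbers of the \<open>i\<close>-th component with the surfaces spanning the \<open>j\<close>-th one.\<close>

definition has_linking_number :: "link \<Rightarrow> 3 \<Rightarrow> 3 \<Rightarrow> int \<Rightarrow> bool" where
  "has_linking_number L i j n \<longleftrightarrow>
     {algebraic_intersection (l i) S | l S.
        l \<in> L \<and> spanning_surface (l j) S \<and> transverse_curve (l i) S} = {n}"


section \<open>C-complexes and the clasp number\<close>

text \<open>\<open>is_clasp K J C\<close>: \<open>C\<close> is an embedded arc with one endpoint in \<open>K\<close>, the other
  in \<open>J\<close>, and no further point in \<open>K \<union> J\<close>.\<close>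

definition is_clasp :: "(real^4) set \<Rightarrow> (real^4) set \<Rightarrow> (real^4) set \<Rightarrow> bool" where
  "is_clasp K J C \<longleftrightarrow> (\<exists>g. arc g \<and> path_image g = C \<and>
     C \<inter> K = {pathstart g} \<and> C \<inter> J = {pathfinish g})"

text \<open>Transversality of surfaces with boundary includes the boundary strata.
  A disjoint union of finitely many arcs is a set with finitely many components, each an arc.\<close>

definition C_complex :: "three_circles \<Rightarrow> (3 \<Rightarrow> oriented_surface) \<Rightarrow> bool" where
  "C_complex l F \<longleftrightarrow>
     (\<forall>i. spanning_surface (l i) (F i)) \<and>
     (\<forall>i j. i \<noteq> j \<longrightarrow> transverse_surfaces (F i) (F j) \<and> transverse_curve (l i) (F j)) \<and>
     (\<forall>i j. i \<noteq> j \<longrightarrow> finite (components (points (F i) \<inter> points (F j))) \<and>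
        (\<forall>C\<in>components (points (F i) \<inter> points (F j)). is_clasp (range (l i)) (range (l j)) C)) \<and>
     points (F 1) \<inter> points (F 2) \<inter> points (F 3) = {}"

definition clasps :: "(3 \<Rightarrow> oriented_surface) \<Rightarrow> 3 \<Rightarrow> 3 \<Rightarrow> (real^4) set set" where
  "clasps F i j = components (points (F i) \<inter> points (F j))"

definition num_clasps :: "(3 \<Rightarrow> oriented_surface) \<Rightarrow> nat" where
  "num_clasps F = card (clasps F 1 2) + card (clasps F 2 3) + card (clasps F 3 1)"

definition clasp_number :: "link \<Rightarrow> nat" where
  "clasp_number L = (LEAST n. \<exists>l F. l \<in> L \<and> C_complex l F \<and> n = num_clasps F)"


section \<open>Clasp-words and the triple linking number\<close>

text \<open>The letter \<open>x\<^sub>j\<close> with exponent \<open>\<epsilon>\<close> is encoded as the pair \<open>(j, \<epsilon>)\<close>.  The base-point of the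
  \<open>k\<close>-th component is \<open>l k (b k)\<close>.\<close>

definition crossing_times ::
    "three_circles \<Rightarrow> (3 \<Rightarrow> oriented_surface) \<Rightarrow> (3 \<Rightarrow> real) \<Rightarrow> 3 \<Rightarrow> real set" where
  "crossing_times l F b k = {t\<in>{b k..<b k + 1}. \<exists>j. j \<noteq> k \<and> l k t \<in> points (F j)}"

definition letter :: "three_circles \<Rightarrow> (3 \<Rightarrow> oriented_surface) \<Rightarrow> 3 \<Rightarrow> real \<Rightarrow> 3 \<times> int" where
  "letter l F k t =
     (let j = (THE j. j \<noteq> k \<and> l k t \<in> points (F j)) in (j, crossing_sign (l k) (F j) t))"

definition clasp_word ::
    "three_circles \<Rightarrow> (3 \<Rightarrow> oriented_surface) \<Rightarrow> (3 \<Rightarrow> real) \<Rightarrow> 3 \<Rightarrow> (3 \<times> int) list" where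
  "clasp_word l F b k = map (letter l F k) (sorted_list_of_set (crossing_times l F b k))"

definition e_sum :: "3 \<Rightarrow> 3 \<Rightarrow> (3 \<times> int) list \<Rightarrow> int" where
  "e_sum i j w = (\<Sum>m<length w. \<Sum>n<m.
     (if fst (w ! n) = i \<and> fst (w ! m) = j then snd (w ! n) * snd (w ! m) else 0))"

definition basepoints :: "three_circles \<Rightarrow> (3 \<Rightarrow> oriented_surface) \<Rightarrow> (3 \<Rightarrow> real) \<Rightarrow> bool" where
  "basepoints l F b \<longleftrightarrow> (\<forall>k j. j \<noteq> k \<longrightarrow> l k (b k) \<notin> points (F j))"

definition Mellor_Melvin ::
    "three_circles \<Rightarrow> (3 \<Rightarrow> oriented_surface) \<Rightarrow> (3 \<Rightarrow> real) \<Rightarrow> int" where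
  "Mellor_Melvin l F b = e_sum 1 2 (clasp_word l F b 3) + e_sum 2 3 (clasp_word l F b 1)
     + e_sum 3 1 (clasp_word l F b 2)"

text \<open>The triple linking number is the common value of the Mellor--Melvin formula over all
  C-complexes and base-points.  By the invariance theorem of Mellor and Melvin this value exists
  whenever the pairwise linking numbers vanish; the default 0 only makes the function total.\<close>

definition has_triple_linking_number :: "link \<Rightarrow> int \<Rightarrow> bool" where
  "has_triple_linking_number L m \<longleftrightarrow>
     {Mellor_Melvin l F b | l F b. l \<in> L \<and> C_complex l F \<and> basepoints l F b} = {m}"

definition triple_linking_number :: "link \<Rightarrow> int" where
  "triple_linking_number L =
     (if \<exists>m. has_triple_linking_number L m then THE m. has_triple_linking_number L m else 0)"

end

theory Submission
  imports Defs "HOL-Library.Periodic_Fun"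
begin

text \<open>Each clasp between \<open>F\<^sub>i\<close> and \<open>F\<^sub>j\<close> contributes exactly one letter \<open>x\<^sub>j\<close> to \<open>w\<^sub>i\<close> and one letter
  \<open>x\<^sub>i\<close> to \<open>w\<^sub>j\<close>.  Hence if \<open>c\<^sub>i\<^sub>j\<close> is the number of these clasps, \<open>w\<^sub>k\<close> has \<open>c\<^sub>i\<^sub>k\<close> letters \<open>x\<^sub>i\<close> and
  \<open>c\<^sub>j\<^sub>k\<close> letters \<open>x\<^sub>j\<close>, in both cases as many positive as negative ones because the linking numbers
  vanish.  The partial sums of the signs of the \<open>x\<^sub>i\<close> form a closed walk of \<open>c\<^sub>i\<^sub>k\<close> unit steps, so they
  lie in an interval of length \<open>c\<^sub>i\<^sub>k/2\<close>, and pairing them with the balanced signs of the \<open>x\<^sub>j\<close> gives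
  \<open>4 \<bar>e\<^sub>i\<^sub>j(w\<^sub>k)\<bar> \<le> c\<^sub>i\<^sub>k c\<^sub>j\<^sub>k\<close>.  With \<open>c\<^sub>i\<^sub>j = 2 p\<^sub>i\<^sub>j\<close> the claim follows from
  \<open>3 (p q + q r + r p) \<le> (p + q + r)\<^sup>2\<close>.\<close>

section \<open>Balanced sequences\<close>

text \<open>As the total is 0, the block between the two indices and its complement have opposite
  sums. The absolute sum of \<open>f\<close> therefore bounds the absolute block sum twice.\<close>

lemma partial_sum_diff_le:
  fixes f :: "nat \<Rightarrow> 'a::linordered_idom"
  assumes "sum f {..<N} = 0" "p \<le> N" "q \<le> N"
  shows "2 * (sum f {..<p} - sum f {..<q}) \<le> (\<Sum>n<N. \<bar>f n\<bar>)"
proof -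
  have split: "sum g {..<N} = sum g {..<p} + sum g {p..<q} + sum g {q..<N}"
    if "p \<le> q" "q \<le> N" for p q :: nat and g :: "nat \<Rightarrow> 'a"
    using that sum.atLeastLessThan_concat[of 0 p q g] sum.atLeastLessThan_concat[of 0 q N g]
    by (simp add: lessThan_atLeast0)
  have head: "sum f {..<q} = sum f {..<p} + sum f {p..<q}" if "p \<le> q" for p q :: nat
    using that sum.atLeastLessThan_concat[of 0 p q f] by (simp add: lessThan_atLeast0)
  have *: "2 * \<bar>sum f {..<q} - sum f {..<p}\<bar> \<le> (\<Sum>n<N. \<bar>f n\<bar>)"
    if "p \<le> q" "q \<le> N" for p q
  proof -
    have "\<bar>sum f {p..<q}\<bar> = \<bar>sum f {..<p} + sum f {q..<N}\<bar>"
      using split[OF that, of f] assms(1) by (intro abs_eq_iff[THEN iffD2])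
        (simp add: algebra_simps eq_neg_iff_add_eq_0)
    also have "\<dots> \<le> (\<Sum>n<p. \<bar>f n\<bar>) + (\<Sum>n=q..<N. \<bar>f n\<bar>)"
      by (rule order_trans[OF abs_triangle_ineq]) (intro add_mono sum_abs)
    finally have "2 * \<bar>sum f {p..<q}\<bar> \<le> (\<Sum>n<N. \<bar>f n\<bar>)"
      using split[OF that, of "\<lambda>n. \<bar>f n\<bar>"] sum_abs[of f "{p..<q}"] by linarith
    then show ?thesis
      by (simp add: head[OF that(1)])
  qed
  show ?thesis
    using *[of p q] *[of q p] assms(2,3)
      abs_ge_self[of "sum f {..<p} - sum f {..<q}"] abs_minus_commute[of "sum f {..<p}" "sum f {..<q}"]
    by (cases "p \<le> q") auto
qed

text \<open>The inner sum is the partial sum \<open>S m\<close> times \<open>g m\<close>. Since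
  \<open>g\<close> sums to 0, \<open>S\<close> may be shifted by a constant. Centred at the midpoint
  of its range, which has length at most \<open>A / 2\<close>, it is bounded by
  \<open>A / 4\<close>.\<close>

lemma balanced_pairing_bound:
  fixes f g :: "nat \<Rightarrow> 'a::linordered_idom"
  assumes f: "sum f {..<N} = 0" and g: "sum g {..<N} = 0"
  shows "4 * \<bar>\<Sum>m<N. \<Sum>n<m. f n * g m\<bar> \<le> (\<Sum>n<N. \<bar>f n\<bar>) * (\<Sum>n<N. \<bar>g n\<bar>)"
proof -
  define S where "S = (\<lambda>m. sum f {..<m})"
  define A where "A = (\<Sum>n<N. \<bar>f n\<bar>)"
  define hi where "hi = Max (S ` {..N})"
  define lo where "lo = Min (S ` {..N})"
  have bounds: "lo \<le> S m" "S m \<le> hi" if "m < N" for m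
    using that by (auto simp: lo_def hi_def)
  have "hi \<in> S ` {..N}" "lo \<in> S ` {..N}"
    unfolding hi_def lo_def by (intro Max_in Min_in; simp)+
  then have range: "2 * (hi - lo) \<le> A"
    using partial_sum_diff_le[OF f] by (auto simp: S_def A_def)
  \<comment> \<open>Doubling puts the midpoint \<open>(hi + lo) / 2\<close> into the ring without
    division.\<close>
  have "2 * (\<Sum>m<N. \<Sum>n<m. f n * g m) = (\<Sum>m<N. (2 * S m - (hi + lo)) * g m) + (hi + lo) * sum g {..<N}"
    by (simp add: S_def sum_distrib_left sum_distrib_right algebra_simps flip: sum.distrib)
  then have e: "2 * (\<Sum>m<N. \<Sum>n<m. f n * g m) = (\<Sum>m<N. (2 * S m - (hi + lo)) * g m)"
    by (simp add: g)
  have "2 * \<bar>\<Sum>m<N. (2 * S m - (hi + lo)) * g m\<bar> \<le> (\<Sum>m<N. 2 * \<bar>(2 * S m - (hi + lo)) * g m\<bar>)"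
    unfolding sum_distrib_left[symmetric] by (intro mult_left_mono sum_abs) simp
  also have "\<dots> \<le> (\<Sum>m<N. A * \<bar>g m\<bar>)"
  proof (rule sum_mono)
    fix m assume "m \<in> {..<N}"
    then have "2 * \<bar>2 * S m - (hi + lo)\<bar> \<le> A"
      using bounds[of m] range by (simp add: abs_if)
    then have "2 * \<bar>2 * S m - (hi + lo)\<bar> * \<bar>g m\<bar> \<le> A * \<bar>g m\<bar>"
      by (intro mult_right_mono) auto
    then show "2 * \<bar>(2 * S m - (hi + lo)) * g m\<bar> \<le> A * \<bar>g m\<bar>"
      by (simp add: abs_mult mult.assoc)
  qed
  finally have "2 * \<bar>2 * (\<Sum>m<N. \<Sum>n<m. f n * g m)\<bar> \<le> A * (\<Sum>m<N. \<bar>g m\<bar>)"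
    unfolding e by (simp only: sum_distrib_left)
  then show ?thesis
    by (simp add: A_def abs_mult)
qed

text \<open>Letters other than the chosen one are kept as zero entries, so both sequences are
  indexed by the positions of the whole word. For signs of modulus 1, \<open>s a abs\<close> counts
  the letters \<open>a\<close>.\<close>

lemma e_sum_bound:
  fixes w :: "(3 \<times> int) list"
  defines "s \<equiv> \<lambda>a h. \<Sum>x\<leftarrow>w. if fst x = a then h (snd x) else 0"
  assumes "s i (\<lambda>x. x) = 0" "s j (\<lambda>x. x) = 0"
  shows "4 * \<bar>e_sum i j w\<bar> \<le> s i abs * s j abs"
proof -
  define f where "f = (\<lambda>a n. if fst (w ! n) = a then snd (w ! n) else 0)"
  have s: "s a (\<lambda>x. x) = sum (f a) {..<length w}" "s a abs = (\<Sum>n<length w. \<bar>f a n\<bar>)" for a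
    by (auto simp: s_def f_def sum_list_sum_nth lessThan_atLeast0 intro!: sum.cong)
  have "e_sum i j w = (\<Sum>m<length w. \<Sum>n<m. f i n * f j m)"
    unfolding e_sum_def f_def by (intro sum.cong) auto
  then show ?thesis
    using balanced_pairing_bound[of "f i" "length w" "f j"] assms(2,3) by (simp add: s)
qed

section \<open>Crossings of a closed curve with a surface\<close>

text \<open>The free starting time \<open>a\<close> covers both the window from 0 in
  \<open>algebraic_intersection\<close> and the window from the base-point in a clasp-word.\<close>

definition crossings :: "(real \<Rightarrow> real^4) \<Rightarrow> oriented_surface \<Rightarrow> real \<Rightarrow> real set" where
  "crossings \<gamma> S a = {t \<in> {a..<a + 1}. \<gamma> t \<in> points S}"

lemma bij_betw_frac: "bij_betw frac {a..<a + 1} {0..<1::real}"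
proof (rule bij_betw_byWitness[where f' = "\<lambda>x. a + frac (x - a)"])
  show "\<forall>t\<in>{a..<a + 1}. a + frac (frac t - a) = t"
  proof
    fix t assume t: "t \<in> {a..<a + 1}"
    have "frac t - a = (t - a) + of_int (- \<lfloor>t\<rfloor>)"
      by (simp add: frac_def)
    then have "frac (frac t - a) = frac (t - a)"
      by (metis frac_def add_diff_cancel_right floor_add_int of_int_add)
    also have "\<dots> = t - a"
      using t by (simp add: frac_eq)
    finally show "a + frac (frac t - a) = t"
      by simp
  qed
  show "\<forall>x\<in>{0..<1}. frac (a + frac (x - a)) = x"
  proof
    fix x :: real assume x: "x \<in> {0..<1}"
    have "a + frac (x - a) = x + of_int (- \<lfloor>x - a\<rfloor>)"
      by (simp add: frac_def)
    then have "frac (a + frac (x - a)) = frac x"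
      by (metis frac_def add_diff_cancel_right floor_add_int of_int_add)
    then show "frac (a + frac (x - a)) = x"
      using x by (simp add: frac_eq)
  qed
qed (auto simp: frac_lt_1)

lemma periodic_frac:
  fixes f :: "real \<Rightarrow> 'a"
  assumes "\<And>t. f (t + 1) = f t"
  shows "f (frac t) = f t"
proof -
  interpret periodic_fun_simple' f
    using assms by unfold_locales
  show ?thesis
    by (simp add: frac_def minus_of_int)
qed

lemma vector_derivative_periodic:
  fixes \<gamma> :: "real \<Rightarrow> 'a::real_normed_vector"
  assumes "\<And>t. \<gamma> (t + p) = \<gamma> t"
  shows "vector_derivative \<gamma> (at (t + p)) = vector_derivative \<gamma> (at t)"
proof -
  \<comment> \<open>\<open>vector_derivative\<close> is a Hilbert choice, so agreement of the two
    predicates for every \<open>D\<close> gives equal values.\<close>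
  have "(\<gamma> has_vector_derivative D) (at (t + p)) \<longleftrightarrow> (\<gamma> has_vector_derivative D) (at t)" for D
  proof
    assume "(\<gamma> has_vector_derivative D) (at (t + p))"
    moreover have "((\<lambda>s. s + p) has_vector_derivative 1) (at t)"
      by (auto intro!: derivative_eq_intros)
    ultimately have "(\<gamma> \<circ> (\<lambda>s. s + p) has_vector_derivative 1 *\<^sub>R D) (at t)"
      by (intro vector_diff_chain_at)
    then show "(\<gamma> has_vector_derivative D) (at t)"
      by (simp add: o_def assms)
  next
    assume "(\<gamma> has_vector_derivative D) (at t)"
    then have "(\<gamma> has_vector_derivative D) (at ((t + p) - p))"
      by simp
    moreover have "((\<lambda>s. s - p) has_vector_derivative 1) (at (t + p))"
      by (auto intro!: derivative_eq_intros)
    ultimately have "(\<gamma> \<circ> (\<lambda>s. s - p) has_vector_derivative 1 *\<^sub>R D) (at (t + p))"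
      by (intro vector_diff_chain_at)
    moreover have "\<gamma> (s - p) = \<gamma> s" for s
      using assms[of "s - p"] by simp
    ultimately show "(\<gamma> has_vector_derivative D) (at (t + p))"
      by (simp add: o_def)
  qed
  then show ?thesis
    by (simp add: vector_derivative_def)
qed

lemma knot_inj_on_period:
  assumes "knot \<gamma>"
  shows "inj_on \<gamma> {a..<a + 1}"
proof -
  have "inj_on (\<gamma> \<circ> frac) {a..<a + 1}"
    using assms bij_betw_frac[of a] by (auto simp: knot_def bij_betw_def intro!: comp_inj_on)
  moreover have "\<gamma> \<circ> frac = \<gamma>"
    using assms by (auto simp: knot_def periodic_frac)
  ultimately show ?thesis
    by simp
qed

lemma sum_crossing_sign:
  assumes "knot \<gamma>"
  shows "(\<Sum>t\<in>crossings \<gamma> S a. crossing_sign \<gamma> S t) = algebraic_intersection \<gamma> S"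
proof -
  have \<gamma>: "\<gamma> (t + 1) = \<gamma> t" for t
    using assms by (simp add: knot_def)
  have per: "\<gamma> (frac t) = \<gamma> t" "crossing_sign \<gamma> S (frac t) = crossing_sign \<gamma> S t" for t
    by (intro periodic_frac, simp add: crossing_sign_def \<gamma> vector_derivative_periodic)+
  have "bij_betw frac (crossings \<gamma> S a) {t \<in> {0..<1}. \<gamma> t \<in> points S}"
  proof (rule bij_betw_subset[OF bij_betw_frac])
    have "{0..<1} = frac ` {a..<a + 1}"
      by (rule bij_betw_imp_surj_on[OF bij_betw_frac, symmetric])
    moreover have "frac ` {t \<in> T. \<gamma> t \<in> points S} = {t \<in> frac ` T. \<gamma> t \<in> points S}" for T
      by (safe; force simp only: per(1))
    ultimately show "frac ` crossings \<gamma> S a = {t \<in> {0..<1}. \<gamma> t \<in> points S}"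
      by (simp only: crossings_def)
  qed (auto simp: crossings_def)
  from sum.reindex_bij_betw[OF this, of "crossing_sign \<gamma> S"] show ?thesis
    by (simp add: per(2) algebraic_intersection_def)
qed

section \<open>Crossings and clasps of a C-complex\<close>

lemma oriented_boundary_subset:
  assumes "oriented_boundary S \<gamma>"
  shows "\<gamma> t \<in> points S"
proof -
  have "\<gamma> t \<in> surface_boundary (points S)"
    using assms by (auto simp: oriented_boundary_def)
  then obtain V \<phi> U v where "surface_chart (points S) V \<phi> U" "v \<in> V" "v $ 1 = 0" "\<gamma> t = \<phi> v"
    by (auto simp: surface_boundary_def)
  then show ?thesis
    unfolding surface_chart_def homeomorphism_def by fastforce
qed

lemma C_complex_boundary_subset:
  assumes "C_complex l F"
  shows "l k t \<in> points (F k)"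
  using assms by (auto simp: C_complex_def spanning_surface_def intro: oriented_boundary_subset)

lemma C_complex_triple_points:
  assumes F: "C_complex l F" and ij: "i \<noteq> j" "i \<noteq> k" "j \<noteq> k"
    and x: "x \<in> points (F i)" "x \<in> points (F j)"
  shows "x \<notin> points (F k)"
proof -
  have "{i, j, k} = {1, 2, 3}"
    using ij exhaust_3[of i] exhaust_3[of j] exhaust_3[of k] by auto
  then have "\<Inter> ((\<lambda>a. points (F a)) ` {i, j, k}) = {}"
    using F by (simp add: C_complex_def Int_assoc)
  with x show ?thesis
    by auto
qed

lemma clasps_commute: "clasps F i j = clasps F j i"
  by (simp add: clasps_def Int_commute)

text \<open>The curve \<open>l k\<close> lies in \<open>F k\<close>, so its crossings with
  \<open>F j\<close> are its points on the clasps. Each clasp meets the curve in exactly one point,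
  its endpoint there.\<close>

lemma bij_betw_crossings_clasps:
  assumes F: "C_complex l F" and l: "knot (l k)" and jk: "j \<noteq> k"
  shows "bij_betw (\<lambda>t. connected_component_set (points (F k) \<inter> points (F j)) (l k t))
    (crossings (l k) (F j) a) (clasps F k j)"
proof -
  define X where "X = points (F k) \<inter> points (F j)"
  have clasp: "\<exists>x. C \<inter> range (l k) = {x}" if "C \<in> components X" for C
    using F jk that unfolding C_complex_def is_clasp_def X_def by metis
  have X: "l k t \<in> X \<longleftrightarrow> l k t \<in> points (F j)" for t
    using C_complex_boundary_subset[OF F] by (auto simp: X_def)
  have "inj_on (\<lambda>t. connected_component_set X (l k t)) (crossings (l k) (F j) a)"
  proof (rule inj_onI)
    fix s t
    assume s: "s \<in> crossings (l k) (F j) a" and t: "t \<in> crossings (l k) (F j) a"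
      and eq: "connected_component_set X (l k s) = connected_component_set X (l k t)"
    let ?C = "connected_component_set X (l k s)"
    have "l k s \<in> X" "l k t \<in> X"
      using s t by (auto simp: crossings_def X)
    then have "?C \<in> components X" "l k s \<in> ?C" "l k t \<in> ?C"
      by (simp add: componentsI, simp, simp add: eq)
    moreover obtain x where "?C \<inter> range (l k) = {x}"
      using clasp calculation(1) by blast
    ultimately have "l k s = l k t"
      by (metis IntI rangeI singletonD)
    with s t show "s = t"
      using knot_inj_on_period[OF l, of a] by (auto simp: crossings_def inj_on_def)
  qed
  moreover have "(\<lambda>t. connected_component_set X (l k t)) ` crossings (l k) (F j) a = components X"
  proof (intro subset_antisym subsetI)
    fix C assume "C \<in> (\<lambda>t. connected_component_set X (l k t)) ` crossings (l k) (F j) a"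
    then show "C \<in> components X"
      by (auto simp: crossings_def X[symmetric] intro: componentsI)
  next
    fix C assume C: "C \<in> components X"
    have "C \<inter> range (l k) \<noteq> {}"
      using clasp[OF C] by auto
    then obtain t where t: "l k t \<in> C"
      by auto
    \<comment> \<open>The time \<open>t\<close> may lie outside the window; a shift by whole periods
      brings it in.\<close>
    have "frac t \<in> frac ` {a..<a + 1}"
      unfolding bij_betw_imp_surj_on[OF bij_betw_frac] by (simp add: frac_lt_1)
    then obtain s where s: "s \<in> {a..<a + 1}" "frac s = frac t"
      by (metis imageE)
    have "l k s = l k t"
      using l s(2) periodic_frac[of "l k"] unfolding knot_def by metis
    moreover have "C = connected_component_set X (l k t)"
      using C t by (elim componentsE) (simp only: connected_component_eq)
    moreover have "l k t \<in> points (F j)"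
      using C t in_components_subset X by blast
    ultimately show "C \<in> (\<lambda>t. connected_component_set X (l k t)) ` crossings (l k) (F j) a"
      using s(1) by (intro image_eqI[of _ _ s]) (simp_all add: crossings_def)
  qed
  ultimately show ?thesis
    by (simp add: bij_betw_def clasps_def X_def)
qed

lemma
  assumes "C_complex l F" "knot (l k)" "j \<noteq> k"
  shows finite_crossings: "finite (crossings (l k) (F j) a)"
    and card_crossings: "card (crossings (l k) (F j) a) = card (clasps F k j)"
  using bij_betw_crossings_clasps[OF assms, of a] assms(1,3)
  by (auto simp: C_complex_def clasps_def bij_betw_finite bij_betw_same_card)

lemma even_card_clasps:
  assumes F: "C_complex l F" and l: "knot (l k)" and jk: "j \<noteq> k"
    and 0: "algebraic_intersection (l k) (F j) = 0"
  shows "even (card (clasps F k j))"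
proof -
  let ?T = "crossings (l k) (F j) 0"
  \<comment> \<open>Every summand is 0 or 2, so a vanishing sum of signs forces an even number of
    crossings.\<close>
  have "even (\<Sum>t\<in>?T. 1 - crossing_sign (l k) (F j) t)"
    by (intro dvd_sum) (auto simp: crossing_sign_def)
  then have "even (int (card ?T))"
    by (simp add: sum_subtractf sum_crossing_sign[OF l] 0)
  then show ?thesis
    using card_crossings[OF F l jk] by simp
qed

lemma ex_basepoints:
  assumes F: "C_complex l F" and l: "\<And>k. knot (l k)"
  shows "\<exists>b. basepoints l F b"
proof -
  have "\<exists>t. \<forall>j. j \<noteq> k \<longrightarrow> l k t \<notin> points (F j)" for k
  proof -
    have "finite (\<Union>j\<in>- {k}. crossings (l k) (F j) 0)"
      using finite_crossings[OF F l] by auto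
    moreover have "infinite {0..<1::real}"
      by (simp add: infinite_Ico)
    ultimately obtain t where "t \<in> {0..<1}" "t \<notin> (\<Union>j\<in>- {k}. crossings (l k) (F j) 0)"
      by (meson finite_subset subsetI)
    then show ?thesis
      by (auto simp: crossings_def)
  qed
  then show ?thesis
    unfolding basepoints_def by metis
qed

section \<open>Clasp-words\<close>

text \<open>The description in \<open>letter\<close> is unique: a second surface through
  \<open>l k t\<close> would create a triple point, as \<open>l k t\<close> lies in
  \<open>F k\<close>.\<close>

lemma letter_eq:
  assumes "C_complex l F" "j \<noteq> k" "l k t \<in> points (F j)"
  shows "letter l F k t = (j, crossing_sign (l k) (F j) t)"
proof -
  have "(THE j. j \<noteq> k \<and> l k t \<in> points (F j)) = j"
  proof (rule the_equality)
    fix i assume "i \<noteq> k \<and> l k t \<in> points (F i)"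
    then show "i = j"
      using C_complex_triple_points[OF assms(1), of i j k] assms(2,3)
        C_complex_boundary_subset[OF assms(1)] by blast
  qed (use assms in simp)
  then show ?thesis
    by (simp add: letter_def)
qed

text \<open>The function \<open>h\<close> is left free for two uses: the identity gives the
  algebraic intersection number, the absolute value gives the number of clasps.\<close>

lemma clasp_word_sum:
  fixes h :: "int \<Rightarrow> 'a::comm_monoid_add"
  assumes F: "C_complex l F" and l: "knot (l k)" and jk: "j \<noteq> k"
  shows "(\<Sum>x\<leftarrow>clasp_word l F b k. if fst x = j then h (snd x) else 0)
    = (\<Sum>t\<in>crossings (l k) (F j) (b k). h (crossing_sign (l k) (F j) t))"
proof -
  let ?T = "crossing_times l F b k"
  have T: "?T = (\<Union>j\<in>- {k}. crossings (l k) (F j) (b k))"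
    by (auto simp: crossing_times_def crossings_def)
  have fin: "finite ?T"
    unfolding T using finite_crossings[OF F l] by auto
  have "(\<Sum>x\<leftarrow>clasp_word l F b k. if fst x = j then h (snd x) else 0)
      = (\<Sum>t\<in>?T. if fst (letter l F k t) = j then h (snd (letter l F k t)) else 0)"
    using fin by (simp add: clasp_word_def o_def sum_list_distinct_conv_sum_set)
  also have "\<dots> = (\<Sum>t\<in>crossings (l k) (F j) (b k). h (crossing_sign (l k) (F j) t))"
  proof (rule sum.mono_neutral_cong_right[OF fin])
    show "crossings (l k) (F j) (b k) \<subseteq> ?T"
      using jk by (auto simp: T)
    show "\<forall>t\<in>?T - crossings (l k) (F j) (b k).
        (if fst (letter l F k t) = j then h (snd (letter l F k t)) else 0) = 0"
      using letter_eq[OF F] by (auto simp: T crossings_def)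
  qed (use letter_eq[OF F jk] in \<open>simp add: crossings_def\<close>)
  finally show ?thesis .
qed

lemma e_sum_clasp_word_bound:
  assumes F: "C_complex l F" and l: "knot (l k)" and ijk: "i \<noteq> k" "j \<noteq> k"
    and 0: "algebraic_intersection (l k) (F i) = 0" "algebraic_intersection (l k) (F j) = 0"
  shows "4 * \<bar>e_sum i j (clasp_word l F b k)\<bar> \<le> int (card (clasps F k i)) * int (card (clasps F k j))"
proof -
  have abs: "(\<Sum>x\<leftarrow>clasp_word l F b k. if fst x = a then \<bar>snd x\<bar> else 0) = int (card (clasps F k a))"
    if "a \<noteq> k" for a
  proof -
    have "\<bar>crossing_sign \<gamma> S t\<bar> = 1" for \<gamma> S t
      by (simp add: crossing_sign_def)
    then show ?thesis
      by (simp add: clasp_word_sum[OF F l that] card_crossings[OF F l that])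
  qed
  have "(\<Sum>x\<leftarrow>clasp_word l F b k. if fst x = a then snd x else 0) = 0" if "a = i \<or> a = j" for a
    using clasp_word_sum[OF F l, of a "\<lambda>x. x" b] sum_crossing_sign[OF l] that ijk 0 by auto
  then show ?thesis
    using e_sum_bound[of i "clasp_word l F b k" j] ijk by (simp add: abs)
qed

section \<open>From clasp-words to the clasp number\<close>

lemma num_clasps_bound:
  assumes F: "C_complex l F" and l: "\<And>k. knot (l k)"
    and 0: "\<And>i j. i \<noteq> j \<Longrightarrow> algebraic_intersection (l i) (F j) = 0"
  shows "2 * \<lceil>sqrt (3 * \<bar>real_of_int (Mellor_Melvin l F b)\<bar>)\<rceil> \<le> int (num_clasps F)"
proof -
  have "even (card (clasps F i j))" if "i \<noteq> j" for i j
    using even_card_clasps[OF F l, of j i] 0 that by simp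
  then have "even (card (clasps F 1 2))" "even (card (clasps F 2 3))" "even (card (clasps F 3 1))"
    by simp_all
  then obtain p q r where pqr: "card (clasps F 1 2) = 2 * p" "card (clasps F 2 3) = 2 * q"
      "card (clasps F 3 1) = 2 * r"
    by (elim evenE)
  have e: "\<bar>e_sum i j (clasp_word l F b k)\<bar> \<le> int (x * y)"
    if "i \<noteq> k" "j \<noteq> k" "card (clasps F k i) = 2 * x" "card (clasps F k j) = 2 * y" for i j k x y
    using e_sum_clasp_word_bound[OF F l that(1,2) 0 0, of b] that by simp
  define \<mu> where "\<mu> = Mellor_Melvin l F b"
  have "\<bar>\<mu>\<bar> \<le> int (r * q) + int (p * r) + int (q * p)"
    using e[of 1 3 2 r q] e[of 2 1 3 p r] e[of 3 2 1 q p] pqr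
      clasps_commute[of F 3 2] clasps_commute[of F 1 3] clasps_commute[of F 2 1]
    by (simp add: \<mu>_def Mellor_Melvin_def)
  then have "3 * \<bar>\<mu>\<bar> \<le> 3 * (int r * int q + int p * int r + int q * int p)"
    by simp
  \<comment> \<open>The difference of the two sides is half the sum of the three squares
    below.\<close>
  also have "\<dots> \<le> (int p + int q + int r)\<^sup>2"
    using zero_le_power2[of "int p - int q"] zero_le_power2[of "int q - int r"]
      zero_le_power2[of "int r - int p"]
    by (simp add: power2_eq_square algebra_simps)
  finally have "real_of_int (3 * \<bar>\<mu>\<bar>) \<le> real_of_int ((int p + int q + int r)\<^sup>2)"
    by (simp only: of_int_le_iff)
  then have "sqrt (3 * \<bar>real_of_int \<mu>\<bar>) \<le> real_of_int (int p + int q + int r)"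
    by (intro real_le_lsqrt) auto
  \<comment> \<open>The bound is an integer, so the ceiling is taken before doubling; this is where
    the evenness of the clasp counts enters.\<close>
  then have "\<lceil>sqrt (3 * \<bar>real_of_int \<mu>\<bar>)\<rceil> \<le> int p + int q + int r"
    by (simp only: ceiling_le_iff)
  then show ?thesis
    by (simp add: num_clasps_def pqr \<mu>_def)
qed

lemma links_embedded:
  assumes "L \<in> links" "l \<in> L"
  shows "embedded_link l"
proof -
  \<comment> \<open>\<open>L\<close> is the class of some \<open>l0\<close>, and \<open>l\<close> is
    the end \<open>s = 1\<close> of an isotopy through embedded links.\<close>
  obtain l0 where "isotopic l0 l"
    using assms by (auto simp: links_def quotient_def)
  then obtain H :: "3 \<Rightarrow> real \<times> real \<Rightarrow> real^4"
    where "\<forall>s\<in>{0..1}. embedded_link (\<lambda>i t. H i (s, t))" "\<forall>i t. H i (1, t) = l i t"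
    unfolding isotopic_def by blast
  then show ?thesis
    by (metis (no_types, lifting) atLeastAtMost_iff ext order_refl zero_le_one)
qed

theorem theorem1:
  fixes L :: link
  assumes "L \<in> links"
    and "\<And>i j. i \<noteq> j \<Longrightarrow> has_linking_number L i j 0"
  shows "int (clasp_number L) \<ge> 2 * \<lceil>sqrt (3 * \<bar>real_of_int (triple_linking_number L)\<bar>)\<rceil>"
proof (cases "\<exists>m. has_triple_linking_number L m")
  \<comment> \<open>The default value 0 makes the right-hand side 0.\<close>
  case False
  then show ?thesis
    by (simp add: triple_linking_number_def)
next
  case True
  then obtain m where m: "{Mellor_Melvin l F b | l F b. l \<in> L \<and> C_complex l F \<and> basepoints l F b} = {m}"
    by (auto simp: has_triple_linking_number_def)
  then have "has_triple_linking_number L = (\<lambda>n. n = m)"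
    by (auto simp: has_triple_linking_number_def)
  then have \<mu>: "triple_linking_number L = m"
    by (simp add: triple_linking_number_def)
  \<comment> \<open>A set equal to \<open>{m}\<close> is nonempty, so some C-complex exists and the
    \<open>LEAST\<close> is attained.\<close>
  have "\<exists>n l F. l \<in> L \<and> C_complex l F \<and> n = num_clasps F"
    using m by blast
  then have "\<exists>l F. l \<in> L \<and> C_complex l F \<and> clasp_number L = num_clasps F"
    unfolding clasp_number_def by (rule LeastI_ex)
  then obtain l F where l: "l \<in> L" and F: "C_complex l F" and C: "clasp_number L = num_clasps F"
    by blast
  have knots: "knot (l k)" for k
    using links_embedded[OF assms(1) l] by (simp add: embedded_link_def)
  obtain b where "basepoints l F b"
    using ex_basepoints[OF F knots] by blast
  with m l F have "Mellor_Melvin l F b = m"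
    by blast
  \<comment> \<open>The surfaces of a C-complex are themselves spanning and transverse to the other
    components, so they compute the linking numbers.\<close>
  moreover have "algebraic_intersection (l i) (F j) = 0" if "i \<noteq> j" for i j
    using assms(2)[OF that] l F that unfolding has_linking_number_def C_complex_def by blast
  ultimately show ?thesis
    using num_clasps_bound[OF F knots, of b] by (simp add: \<mu> C)
qed

end
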